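(* Let $q$ be a prime power and $\theta$ a generator of $\mathbb{F}_{q^2}^*$. Then the graph $G_{q,\theta}$ is $C_4$-saturated. Moreover, when $q$ is a power of $2$ and $q>4$, the graph $H_{q,\theta}$ is $C_4$-saturated.
   Context: Let $A(q,\theta)=\{a\in\mathbb{Z}_{q^2-1} : \theta^a-\theta\in\mathbb{F}_q\}$. $G_{q,\theta}$ is the simple graph (no loops) with vertex set $\mathbb{Z}_{q^2-1}$ in which two distinct vertices $x,y$ are adjacent if and only if $x+y\in A(q,\theta)$. A vertex $y$ with $y+y\in A(q,\theta)$ is called an absolute point. When $q$ is a power of $2$, $G_{q,\theta}$ has exactly $q$ absolute points and there is a unique vertex $x$ whose neighborhood is exactly the set of absolute points; $H_{q,\theta}$ is the induced subgraph of $G_{q,\theta}$ obtained by deleting $x$ and all neighbors of $x$. A graph $G$ is $C_4$-saturated if $G$ contains no $4$-cycle and adding any edge between two nonadjacent vertices of $G$ creates a $4$-cycle.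
   Formalization: The case q = 2 is excluded: there G_{2,θ} is a path on three vertices, and adding the missing edge gives a triangle, which has no 4-cycle, so the first claim fails for q = 2. *)

theory Defs
  imports
    "HOL-Algebra.Subrings"
    "HOL-Algebra.Multiplicative_Group"
    "HOL-Algebra.Generated_Groups"
    "HOL-Number_Theory.Residues"
    "HOL-Number_Theory.Prime_Powers"
    "Graph_Theory.Pair_Digraph"
begin

section \<open>Saturated graphs\<close>

text \<open>
  Finite simple graphs are symmetric, loop-free digraphs whose arcs are pairs of vertices, i.e. the
  locale \<^locale>\<open>pair_graph\<close>; an undirected edge is represented by both of its orientations.
\<close>

definition neighborhood :: "'v pair_pre_digraph \<Rightarrow> 'v \<Rightarrow> 'v set" where
  "neighborhood G x = {y. (x, y) \<in> parcs G}"

definition induced_on :: "'v pair_pre_digraph \<Rightarrow> 'v set \<Rightarrow> 'v pair_pre_digraph" where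
  "induced_on G W = \<lparr> pverts = W, parcs = parcs G \<inter> W \<times> W \<rparr>"

definition add_edge :: "'v pair_pre_digraph \<Rightarrow> 'v \<Rightarrow> 'v \<Rightarrow> 'v pair_pre_digraph" where
  "add_edge G x y = \<lparr> pverts = pverts G, parcs = parcs G \<union> {(x, y), (y, x)} \<rparr>"

text \<open>
  A directed cycle in the sense of \<^const>\<open>pre_digraph.cycle\<close> is a closed walk on pairwise distinct
  vertices. In a symmetric digraph this includes the back-and-forth walk of length 2, but those of
  length 4 are exactly the 4-cycles of the undirected graph.
\<close>

definition contains_C4 :: "'v pair_pre_digraph \<Rightarrow> bool" where
  "contains_C4 G \<longleftrightarrow> (\<exists>p. pre_digraph.cycle (with_proj G) p \<and> length p = 4)"

definition C4_saturated :: "'v pair_pre_digraph \<Rightarrow> bool" where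
  "C4_saturated G \<longleftrightarrow>
     pair_graph G \<and>
     \<not> contains_C4 G \<and>
     (\<forall>x \<in> pverts G. \<forall>y \<in> pverts G.
        x \<noteq> y \<longrightarrow> (x, y) \<notin> parcs G \<longrightarrow> contains_C4 (add_edge G x y))"


section \<open>The graphs $G_{q,\theta}$ and $H_{q,\theta}$\<close>

text \<open>
  Throughout, \<open>F\<close> is a field with \<open>q\<^sup>2\<close> elements, \<open>K\<close> its subfield with \<open>q\<close> elements, and \<open>\<theta>\<close> a
  generator of the multiplicative group of \<open>F\<close>. The residues modulo \<open>q\<^sup>2 - 1\<close> are represented by
  \<open>{0..q\<^sup>2 - 2}\<close>, the carrier of \<^const>\<open>residue_ring\<close>.
\<close>

abbreviation Zmod :: "nat \<Rightarrow> int ring" where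
  "Zmod q \<equiv> residue_ring (int q ^ 2 - 1)"

definition A_set :: "nat \<Rightarrow> ('a, 'b) ring_scheme \<Rightarrow> 'a set \<Rightarrow> 'a \<Rightarrow> int set" where
  "A_set q F K \<theta> = {a \<in> carrier (Zmod q). (\<theta> [^]\<^bsub>mult_of F\<^esub> a) \<ominus>\<^bsub>F\<^esub> \<theta> \<in> K}"

definition G_graph :: "nat \<Rightarrow> ('a, 'b) ring_scheme \<Rightarrow> 'a set \<Rightarrow> 'a \<Rightarrow> int pair_pre_digraph" where
  "G_graph q F K \<theta> =
     \<lparr> pverts = carrier (Zmod q),
       parcs = {(x, y). x \<in> carrier (Zmod q) \<and> y \<in> carrier (Zmod q) \<and> x \<noteq> y \<and>
                        x \<oplus>\<^bsub>Zmod q\<^esub> y \<in> A_set q F K \<theta>} \<rparr>"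

definition absolute_points :: "nat \<Rightarrow> ('a, 'b) ring_scheme \<Rightarrow> 'a set \<Rightarrow> 'a \<Rightarrow> int set" where
  "absolute_points q F K \<theta> = {y \<in> carrier (Zmod q). y \<oplus>\<^bsub>Zmod q\<^esub> y \<in> A_set q F K \<theta>}"

text \<open>
  The following vertex exists and is unique when \<open>q\<close> is a power of 2; otherwise the description
  need not denote.
\<close>

definition center :: "nat \<Rightarrow> ('a, 'b) ring_scheme \<Rightarrow> 'a set \<Rightarrow> 'a \<Rightarrow> int" where
  "center q F K \<theta> =
     (THE x. x \<in> pverts (G_graph q F K \<theta>) \<and>
             neighborhood (G_graph q F K \<theta>) x = absolute_points q F K \<theta>)"

definition H_graph :: "nat \<Rightarrow> ('a, 'b) ring_scheme \<Rightarrow> 'a set \<Rightarrow> 'a \<Rightarrow> int pair_pre_digraph" where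
  "H_graph q F K \<theta> =
     (let G = G_graph q F K \<theta>; x = center q F K \<theta>
      in induced_on G (pverts G - ({x} \<union> neighborhood G x)))"

end

theory Submission
  imports Defs
begin

text \<open>
  Identify the residue \<open>i\<close> with \<open>\<theta>\<^sup>i\<close>: two nonzero field elements \<open>u \<noteq> v\<close> are adjacent iff
  \<open>u v \<in> \<theta> + K\<close>. Every \<open>u\<close> has \<open>q\<close> neighbours (counting \<open>u\<close> itself if it is absolute), two distinct
  elements have no common neighbour if they are \<open>K\<close>-proportional, and exactly one otherwise. So there
  are no 4-cycles. To join nonadjacent \<open>u\<close> and \<open>v\<close> by a path \<open>u, a, b, v\<close>, choose a neighbour \<open>a\<close> of
  \<open>u\<close> not proportional to \<open>v\<close> and let \<open>b\<close> be the common neighbour of \<open>a\<close> and \<open>v\<close>; the choices of \<open>a\<close>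
  that fail are at most three, and for \<open>q = 3\<close> at most two.

  For even \<open>q\<close> let \<open>\<eta>\<^sup>2 = \<theta>\<close>. Squaring is additive and bijective on \<open>K\<close>, so the absolute points are
  \<open>\<eta> + K\<close>, which is the neighbourhood of the element \<open>x\<close> of \<open>K\<close> with \<open>\<theta> \<in> K + x \<eta>\<close>. After \<open>x\<close> and its
  neighbours are deleted no absolute points are left, and again at most three choices of \<open>a\<close> fail.
\<close>

section \<open>Saturation of graphs given by a relation\<close>

text \<open>A closed walk with four arcs is determined by the tails of its arcs. The library asks
  for distinctness only after the first vertex, which is enough because the walk returns to its
  start.\<close>

lemma contains_C4_iff:
  assumes "pair_wf_digraph G"
  shows "contains_C4 G \<longleftrightarrow> (\<exists>a b c d. distinct [a, b, c, d] \<and>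
    (a, b) \<in> parcs G \<and> (b, c) \<in> parcs G \<and> (c, d) \<in> parcs G \<and> (d, a) \<in> parcs G)"
proof -
  interpret pair_wf_digraph G by fact
  have cycle_iff: "cycle p \<longleftrightarrow>
      (\<exists>u. u \<in> pverts G \<and> set p \<subseteq> parcs G \<and> pcas u p u \<and> distinct (tl (pawalk_verts u p)) \<and> p \<noteq> [])"
    for p by (simp add: cycle_def awalk_def)
  show ?thesis
  proof
    assume "contains_C4 G"
    then obtain p u where p: "set p \<subseteq> parcs G" "pcas u p u" "distinct (tl (pawalk_verts u p))"
      and "length p = 4"
      unfolding contains_C4_def cycle_iff by auto
    from \<open>length p = 4\<close> obtain e1 e2 e3 e4 where e: "p = [e1, e2, e3, e4]"
      by (auto simp: numeral_eq_Suc length_Suc_conv)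
    show "\<exists>a b c d. distinct [a, b, c, d] \<and>
      (a, b) \<in> parcs G \<and> (b, c) \<in> parcs G \<and> (c, d) \<in> parcs G \<and> (d, a) \<in> parcs G"
      using p unfolding e
      by (intro exI[of _ "fst e1"] exI[of _ "fst e2"] exI[of _ "fst e3"] exI[of _ "fst e4"])
        (cases e1; cases e2; cases e3; cases e4; auto)
  next
    assume "\<exists>a b c d. distinct [a, b, c, d] \<and>
      (a, b) \<in> parcs G \<and> (b, c) \<in> parcs G \<and> (c, d) \<in> parcs G \<and> (d, a) \<in> parcs G"
    then obtain a b c d where "distinct [a, b, c, d]" and arcs:
      "(a, b) \<in> parcs G" "(b, c) \<in> parcs G" "(c, d) \<in> parcs G" "(d, a) \<in> parcs G"
      by blast
    moreover have "a \<in> pverts G" using arc_fst_in_verts[OF arcs(1)] by simp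
    ultimately have "cycle [(a, b), (b, c), (c, d), (d, a)]"
      unfolding cycle_iff by (intro exI[of _ a]) auto
    then show "contains_C4 G"
      unfolding contains_C4_def by (intro exI[of _ "[(a, b), (b, c), (c, d), (d, a)]"]) simp
  qed
qed

text \<open>\<open>R\<close> may hold between a vertex and itself. Loops are dropped only when the
  arcs are formed, so \<open>R\<close> keeps the information about absolute points.\<close>

definition relation_graph :: "'v set \<Rightarrow> ('v \<Rightarrow> 'v \<Rightarrow> bool) \<Rightarrow> 'v pair_pre_digraph" where
  "relation_graph W R = \<lparr>pverts = W, parcs = {(x, y). x \<in> W \<and> y \<in> W \<and> x \<noteq> y \<and> R x y}\<rparr>"

lemma pair_graph_relation_graph:
  assumes "finite W" "\<And>x y. x \<in> W \<Longrightarrow> y \<in> W \<Longrightarrow> R x y \<Longrightarrow> R y x"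
  shows "pair_graph (relation_graph W R)"
proof -
  have "finite {(x, y). x \<in> W \<and> y \<in> W \<and> x \<noteq> y \<and> R x y}"
    by (rule finite_subset[of _ "W \<times> W"]) (use assms(1) in auto)
  then show ?thesis
    using assms by unfold_locales (auto simp: relation_graph_def symmetric_def sym_def)
qed

text \<open>In a 4-cycle two opposite vertices have the other two as common neighbours, against
  \<open>unique\<close>. The path of length three given by \<open>path\<close> is closed by the
  added edge.\<close>

lemma C4_saturated_relation_graphI:
  assumes "finite W" and sym: "\<And>x y. x \<in> W \<Longrightarrow> y \<in> W \<Longrightarrow> R x y \<Longrightarrow> R y x"
    and unique: "\<And>u v w w'. \<lbrakk>u \<in> W; v \<in> W; w \<in> W; w' \<in> W; R u w; R v w; R u w'; R v w'\<rbrakk>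
      \<Longrightarrow> u = v \<or> w = w'"
    and path: "\<And>u v. \<lbrakk>u \<in> W; v \<in> W; u \<noteq> v; \<not> R u v\<rbrakk> \<Longrightarrow>
      \<exists>a\<in>W. \<exists>b\<in>W. a \<noteq> u \<and> a \<noteq> b \<and> b \<noteq> v \<and> R u a \<and> R a b \<and> R b v"
  shows "C4_saturated (relation_graph W R)"
proof -
  let ?G = "relation_graph W R"
  interpret pair_graph ?G by (rule pair_graph_relation_graph[OF assms(1) sym])
  have "\<not> contains_C4 ?G"
  proof
    assume "contains_C4 ?G"
    then obtain a b c d where "distinct [a, b, c, d]"
      "(a, b) \<in> parcs ?G" "(b, c) \<in> parcs ?G" "(c, d) \<in> parcs ?G" "(d, a) \<in> parcs ?G"
      unfolding contains_C4_iff[OF pair_wf_digraph_axioms] by blast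
    then show False using unique[of a c b d] sym by (auto simp: relation_graph_def)
  qed
  moreover have "contains_C4 (add_edge ?G u v)"
    if uv: "u \<in> W" "v \<in> W" "u \<noteq> v" "(u, v) \<notin> parcs ?G" for u v
  proof -
    have "\<not> R u v" using uv by (auto simp: relation_graph_def)
    then obtain a b where ab: "a \<in> W" "b \<in> W" "a \<noteq> u" "a \<noteq> b" "b \<noteq> v" "R u a" "R a b" "R b v"
      using path[of u v] uv by blast
    \<comment> \<open>Either equality would turn an edge of the path into the excluded
      \<open>R u v\<close>.\<close>
    moreover have "a \<noteq> v" "b \<noteq> u"
      using ab \<open>\<not> R u v\<close> by auto
    moreover have "pair_wf_digraph (add_edge ?G u v)"
      using uv by unfold_locales (auto simp: add_edge_def relation_graph_def)
    ultimately show ?thesis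
      unfolding contains_C4_iff[OF \<open>pair_wf_digraph (add_edge ?G u v)\<close>] using uv
      by (intro exI[of _ u] exI[of _ a] exI[of _ b] exI[of _ v])
        (auto simp: add_edge_def relation_graph_def)
  qed
  ultimately show ?thesis
    unfolding C4_saturated_def using pair_graph_axioms by (auto simp: relation_graph_def)
qed

section \<open>Choosing an element outside three small sets\<close>

lemma card_le_1I: "(\<And>x y. x \<in> A \<Longrightarrow> y \<in> A \<Longrightarrow> x = y) \<Longrightarrow> card A \<le> 1"
  by (metis card.empty is_singletonI' is_singleton_altdef le_numeral_extra(4) zero_le)

text \<open>Three sets with at most one element each cover at most three elements, and cover three
  only if none of them is empty; \<open>three\<close> excludes this borderline case.\<close>

lemma exists_outside_three:
  assumes card: "card N \<ge> 3"
    and le: "card A \<le> 1" "card B \<le> 1" "card C \<le> 1" "finite A" "finite B" "finite C"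
    and three: "card N = 3 \<Longrightarrow> A = {} \<or> B = {} \<or> C = {}"
  obtains a where "a \<in> N" "a \<notin> A" "a \<notin> B" "a \<notin> C"
proof -
  have "\<not> N \<subseteq> A \<union> B \<union> C"
  proof
    assume "N \<subseteq> A \<union> B \<union> C"
    then have "card N \<le> card (A \<union> B \<union> C)"
      using le by (intro card_mono) auto
    also have "\<dots> \<le> card A + card B + card C"
      using card_Un_le[of "A \<union> B" C] card_Un_le[of A B] by linarith
    finally have "card N \<le> card A + card B + card C" .
    with le card have "card N = 3" "card A = 1" "card B = 1" "card C = 1" by linarith+
    with three show False by auto
  qed
  then show ?thesis using that by blast
qed

section \<open>Polarities with a parallelism\<close>

text \<open>
  \<open>R\<close> is the adjacency relation including loops (\<open>R u u\<close> says that \<open>u\<close> is absolute), and \<open>P\<close> is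
  proportionality.
\<close>

locale polarity_plane =
  fixes V :: "'v set" and R :: "'v \<Rightarrow> 'v \<Rightarrow> bool" and P :: "'v \<Rightarrow> 'v \<Rightarrow> bool" and q :: nat
  assumes finite_V: "finite V"
    and R_sym: "\<lbrakk>u \<in> V; v \<in> V; R u v\<rbrakk> \<Longrightarrow> R v u"
    and card_nbrs: "u \<in> V \<Longrightarrow> card {w \<in> V. R u w} = q"
    and P_sym: "\<lbrakk>u \<in> V; v \<in> V; P u v\<rbrakk> \<Longrightarrow> P v u"
    and P_trans: "\<lbrakk>u \<in> V; v \<in> V; w \<in> V; P u v; P v w\<rbrakk> \<Longrightarrow> P u w"
    and common_unique: "\<lbrakk>u \<in> V; v \<in> V; w \<in> V; w' \<in> V; R u w; R v w; R u w'; R v w'\<rbrakk>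
      \<Longrightarrow> u = v \<or> w = w'"
    and P_common: "\<lbrakk>u \<in> V; v \<in> V; w \<in> V; P u v; R u w; R v w\<rbrakk> \<Longrightarrow> u = v"
    and common_exists: "\<lbrakk>u \<in> V; v \<in> V; \<not> P u v\<rbrakk> \<Longrightarrow> \<exists>w\<in>V. R u w \<and> R v w"
begin

text \<open>By transitivity \<open>a\<close> and \<open>a'\<close> are proportional, and they have
  the common neighbour \<open>u\<close>.\<close>

lemma parallel_nbr_unique:
  assumes "u \<in> V" "v \<in> V" "a \<in> V" "a' \<in> V" "R u a" "R u a'" "P a v" "P a' v"
  shows "a = a'"
  using assms P_common[of a a' u] P_trans[of a v a'] P_sym R_sym by blast

text \<open>Otherwise \<open>u\<close> and \<open>a\<close> would be distinct and have both
  \<open>u\<close> and \<open>a\<close> as common neighbours.\<close>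

lemma absolute_nbr_unique:
  assumes "u \<in> V" "a \<in> V" "R u u" "R u a" "R a a"
  shows "u = a"
  using assms common_unique[of u a u a] R_sym by blast

lemma C4_saturated_polarity_graph:
  assumes "q \<ge> 3"
    and absolute: "\<And>u v. \<lbrakk>q = 3; u \<in> V; v \<in> V; P u v; R v v\<rbrakk> \<Longrightarrow> R u u"
  shows "C4_saturated (relation_graph V R)"
proof (rule C4_saturated_relation_graphI[OF finite_V R_sym common_unique])
  fix u v assume u: "u \<in> V" and v: "v \<in> V" and "u \<noteq> v" and nR: "\<not> R u v"
  \<comment> \<open>\<open>B\<close> collects the \<open>a\<close> that may have no common neighbour
    \<open>b\<close> with \<open>v\<close>; \<open>C\<close> collects those for which
    \<open>b\<close> could be \<open>a\<close> or \<open>v\<close>, which both force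
    \<open>R v a\<close>.\<close>
  define N where "N = {a \<in> V. R u a}"
  define B where "B = {a \<in> N - {u}. P a v}"
  define C where "C = {a \<in> N - {u}. R v a \<and> (R a a \<or> R v v)}"
  \<comment> \<open>If all three sets were nonempty, \<open>u\<close> would be absolute. The element
    of \<open>C\<close> is then not absolute, so \<open>v\<close> is, and by \<open>absolute\<close>
    so is the element of \<open>B\<close>: a second absolute point adjacent to
    \<open>u\<close>.\<close>
  have "B = {} \<or> C = {} \<or> u \<notin> N" if "q = 3"
    using absolute[OF that _ v] absolute_nbr_unique[OF u] unfolding B_def C_def N_def by auto
  moreover have "card N = q" unfolding N_def by (rule card_nbrs[OF u])
  moreover have "card B \<le> 1" "card C \<le> 1" "card (N \<inter> {u}) \<le> 1"
    using parallel_nbr_unique[OF u v] common_unique[OF u v] \<open>u \<noteq> v\<close>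
    unfolding B_def C_def N_def by (intro card_le_1I; blast)+
  moreover have "finite B" "finite C" "finite (N \<inter> {u})"
    using finite_V unfolding B_def C_def N_def by auto
  ultimately obtain a where a: "a \<in> N" "a \<notin> B" "a \<notin> C" "a \<notin> N \<inter> {u}"
    using \<open>q \<ge> 3\<close> exists_outside_three[of N B C "N \<inter> {u}"] by auto
  then obtain b where "b \<in> V" "R a b" "R v b"
    using common_exists[OF _ v] unfolding B_def N_def by blast
  with a u v show "\<exists>a\<in>V. \<exists>b\<in>V. a \<noteq> u \<and> a \<noteq> b \<and> b \<noteq> v \<and> R u a \<and> R a b \<and> R b v"
    using R_sym unfolding B_def C_def N_def by (intro bexI[of _ a] bexI[of _ b]) auto
qed

lemma C4_saturated_delete_center:
  assumes "q > 3" and x: "x \<in> V" and center: "\<And>u. u \<in> V \<Longrightarrow> R x u \<longleftrightarrow> R u u"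
  shows "C4_saturated (relation_graph (V - ({x} \<union> {y \<in> V. R x y})) R)"
    (is "C4_saturated (relation_graph ?W R)")
proof (rule C4_saturated_relation_graphI)
  show "finite ?W" using finite_V by simp
next
  fix u v assume uv: "u \<in> ?W" "v \<in> ?W" "u \<noteq> v" and nR: "\<not> R u v"
  then have u: "u \<in> V" and v: "v \<in> V" by auto
  define N where "N = {a \<in> V. R u a}"
  define B where "B = {a \<in> N. P a v}"
  \<comment> \<open>\<open>C\<close> and \<open>D\<close> hold the \<open>a\<close> that are deleted
    themselves or whose partner \<open>b\<close> is deleted as a neighbour of
    \<open>x\<close>.\<close>
  define C where "C = {a \<in> N. R x a}"
  define D where "D = {a \<in> N. \<exists>b\<in>V. R x b \<and> R v b \<and> R a b}"
  have "card N = q" unfolding N_def by (rule card_nbrs[OF u])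
  \<comment> \<open>The deleted partner is the unique common neighbour of \<open>x\<close> and
    \<open>v\<close>, hence the same for all of \<open>D\<close>; it differs from \<open>u\<close>,
    so the two share at most one neighbour.\<close>
  moreover have "a = a'" if aa': "a \<in> D" "a' \<in> D" for a a'
  proof -
    from aa' obtain b b' where b: "b \<in> V" "R x b" "R v b" "R a b" "b' \<in> V" "R x b'" "R v b'" "R a' b'"
      unfolding D_def by blast
    then have "b = b'" using common_unique[OF x v, of b b'] uv by auto
    moreover have "b \<noteq> u" using b uv R_sym by auto
    ultimately show ?thesis
      using common_unique[OF u \<open>b \<in> V\<close>, of a a'] aa' b R_sym unfolding D_def N_def by blast
  qed
  then have "card D \<le> 1" by (rule card_le_1I)
  moreover have "card B \<le> 1" "card C \<le> 1"
    using parallel_nbr_unique[OF u v] common_unique[OF x u] uv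
    unfolding B_def C_def N_def by (intro card_le_1I; blast)+
  moreover have "finite B" "finite C" "finite D"
    using finite_V unfolding B_def C_def D_def N_def by auto
  ultimately obtain a where a: "a \<in> N" "a \<notin> B" "a \<notin> C" "a \<notin> D"
    using \<open>q > 3\<close> exists_outside_three[of N B C D] by auto
  then obtain b where b: "b \<in> V" "R a b" "R v b"
    using common_exists[OF _ v] unfolding B_def N_def by blast
  \<comment> \<open>As \<open>u\<close> and \<open>v\<close> are not adjacent to \<open>x\<close>,
    neither \<open>a\<close> nor \<open>b\<close> equals \<open>x\<close>. All remaining vertices
    are non-absolute by \<open>center\<close>, which makes consecutive vertices of the path
    distinct.\<close>
  have "a \<in> V" "R u a" "\<not> R x a" "\<not> R x b" "\<not> R u x" "\<not> R v x"
    using a b uv x R_sym unfolding C_def D_def N_def by auto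
  then show "\<exists>a\<in>?W. \<exists>b\<in>?W. a \<noteq> u \<and> a \<noteq> b \<and> b \<noteq> v \<and> R u a \<and> R a b \<and> R b v"
    using b uv center R_sym by (intro bexI[of _ a] bexI[of _ b]) auto
qed (use R_sym common_unique in blast)+

text \<open>Since \<open>q\<close> is at least 2, there are two absolute points adjacent to both
  \<open>x\<close> and \<open>x'\<close>.\<close>

lemma center_unique:
  assumes "q \<ge> 2" and x: "x \<in> V" and center: "\<And>u. u \<in> V \<Longrightarrow> R x u \<longleftrightarrow> R u u"
    and x': "x' \<in> V" "{y \<in> V. x' \<noteq> y \<and> R x' y} = {y \<in> V. R y y}"
  shows "x' = x"
proof -
  have "card {w \<in> V. R x w} \<ge> 2" using card_nbrs[OF x] \<open>q \<ge> 2\<close> by simp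
  then obtain w w' where "w \<noteq> w'" "w \<in> V" "w' \<in> V" "R x w" "R x w'"
    by (metis (no_types, lifting) card_le_1I mem_Collect_eq not_less_eq_eq numeral_2_eq_2 One_nat_def)
  then show ?thesis
    using common_unique[OF x'(1) x, of w w'] x'(2) center by blast
qed

text \<open>This carries the structure from nonzero field elements to their exponents.\<close>

lemma polarity_plane_pullback:
  assumes bij: "bij_betw f W V"
  shows "polarity_plane W (\<lambda>x y. R (f x) (f y)) (\<lambda>x y. P (f x) (f y)) q"
proof
  show "finite W" using bij_betw_finite[OF bij] finite_V by simp
  have f: "f x \<in> V" if "x \<in> W" for x using bij that by (rule bij_betwE[THEN bspec])
  have inj: "f x = f y \<longleftrightarrow> x = y" if "x \<in> W" "y \<in> W" for x y
    using bij that by (auto simp: bij_betw_def inj_on_eq_iff)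
  have surj: "\<exists>x\<in>W. f x = y" if "y \<in> V" for y
    using bij that by (auto simp: bij_betw_def)
  show "card {y \<in> W. R (f x) (f y)} = q" if "x \<in> W" for x
  proof -
    have "bij_betw f {y \<in> W. R (f x) (f y)} {w \<in> V. R (f x) w}"
      using bij by (auto simp: bij_betw_def inj_on_def)
    then show ?thesis using card_nbrs[OF f[OF that]] by (simp add: bij_betw_same_card)
  qed
  show "\<exists>w\<in>W. R (f u) (f w) \<and> R (f v) (f w)" if "u \<in> W" "v \<in> W" "\<not> P (f u) (f v)" for u v
    using common_exists[OF f f] that surj by metis
  show "u = v \<or> w = w'" if "u \<in> W" "v \<in> W" "w \<in> W" "w' \<in> W"
    "R (f u) (f w)" "R (f v) (f w)" "R (f u) (f w')" "R (f v) (f w')" for u v w w'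
    using common_unique[OF f f f f] that inj by metis
  show "u = v" if "u \<in> W" "v \<in> W" "w \<in> W" "P (f u) (f v)" "R (f u) (f w)" "R (f v) (f w)" for u v w
    using P_common[OF f f f] that inj by metis
  show "P (f u) (f w)" if "u \<in> W" "v \<in> W" "w \<in> W" "P (f u) (f v)" "P (f v) (f w)" for u v w
    using P_trans[OF f f f] that by metis
qed (use R_sym P_sym bij_betwE[OF bij] in blast)+

end

section \<open>Quadratic extensions\<close>

locale quadratic_extension = field F for F (structure) +
  fixes K :: "'a set" and \<theta> :: 'a and q :: nat
  assumes finite_F: "finite (carrier F)"
    and order_F: "order F = q ^ 2"
    and K: "subfield K F"
    and card_K: "card K = q"
    and \<theta>_closed [simp, intro]: "\<theta> \<in> carrier F"
    and \<theta>_notin: "\<theta> \<notin> K"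
begin

lemma K_carrier [simp, intro]: "k \<in> K \<Longrightarrow> k \<in> carrier F"
  using subfieldE(3)[OF K] by blast

lemmas K_closed [simp, intro] = subringE(2,3,5,6,7)[OF subfieldE(1)[OF K]]

lemma K_minus [simp, intro]: "k \<in> K \<Longrightarrow> l \<in> K \<Longrightarrow> k \<ominus> l \<in> K"
  by (simp add: a_minus_def)

lemma K_pow [simp, intro]: "k \<in> K \<Longrightarrow> k [^] (n::nat) \<in> K"
  by (induction n) auto

lemma finite_K: "finite K"
  using finite_F subfieldE(3)[OF K] by (rule rev_finite_subset)

lemma K_cancel: "\<lbrakk>k \<in> K; k \<noteq> \<zero>; a \<in> carrier F; k \<otimes> a \<in> K\<rbrakk> \<Longrightarrow> a \<in> K"
  using subfield_m_inv_simprule[OF K] by blast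

text \<open>If \<open>l\<close> and \<open>l'\<close> differed, dividing by the difference would put
  \<open>c\<close> into \<open>K\<close>.\<close>

lemma coefficients_unique:
  assumes "k \<in> K" "l \<in> K" "k' \<in> K" "l' \<in> K" "c \<in> carrier F" "c \<notin> K"
    and eq: "k \<oplus> l \<otimes> c = k' \<oplus> l' \<otimes> c"
  shows "k = k' \<and> l = l'"
proof -
  note carr = assms(1-4)[THEN K_carrier] assms(5)
  have "(l \<ominus> l') \<otimes> c = (k \<oplus> l \<otimes> c) \<ominus> k \<ominus> l' \<otimes> c"
    using carr by algebra
  also have "\<dots> = k' \<ominus> k"
    unfolding eq using carr by algebra
  finally have "(l \<ominus> l') \<otimes> c \<in> K" using assms by simp
  then have "l \<ominus> l' = \<zero>" using K_cancel[of "l \<ominus> l'" c] assms by blast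
  then have "l = l'" using assms by simp
  with eq show ?thesis using assms by simp
qed

text \<open>By uniqueness the \<open>q^2\<close> coefficient pairs have distinct values, which
  exhaust the \<open>q^2\<close> elements of \<open>F\<close>.\<close>

lemma coefficients_exist:
  assumes "c \<in> carrier F" "c \<notin> K" "f \<in> carrier F"
  shows "\<exists>k\<in>K. \<exists>l\<in>K. f = k \<oplus> l \<otimes> c"
proof -
  let ?h = "\<lambda>(k, l). k \<oplus> l \<otimes> c"
  have "inj_on ?h (K \<times> K)"
    using coefficients_unique[OF _ _ _ _ assms(1,2)] by (auto simp: inj_on_def)
  then have "card (?h ` (K \<times> K)) = card (carrier F)"
    using card_K order_F by (simp add: card_image card_cartesian_product order_def power2_eq_square)
  moreover have "?h ` (K \<times> K) \<subseteq> carrier F" using assms by auto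
  ultimately have "?h ` (K \<times> K) = carrier F"
    using finite_F by (simp add: card_subset_eq)
  then have "f \<in> ?h ` (K \<times> K)" using assms(3) by simp
  then show ?thesis by force
qed

definition adj :: "'a \<Rightarrow> 'a \<Rightarrow> bool" where
  "adj u v \<longleftrightarrow> (\<exists>k\<in>K. u \<otimes> v = \<theta> \<oplus> k)"

text \<open>The factor may be \<open>\<zero>\<close>, so symmetry holds only between nonzero
  elements.\<close>

definition par :: "'a \<Rightarrow> 'a \<Rightarrow> bool" where
  "par u v \<longleftrightarrow> (\<exists>c\<in>K. v = c \<otimes> u)"

lemma adj_iff: "\<lbrakk>u \<in> carrier F; v \<in> carrier F\<rbrakk> \<Longrightarrow> adj u v \<longleftrightarrow> u \<otimes> v \<ominus> \<theta> \<in> K"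
proof
  assume uv: "u \<in> carrier F" "v \<in> carrier F"
  assume "u \<otimes> v \<ominus> \<theta> \<in> K"
  moreover have "u \<otimes> v = \<theta> \<oplus> (u \<otimes> v \<ominus> \<theta>)" using uv \<theta>_closed by algebra
  ultimately show "adj u v" unfolding adj_def by blast
next
  assume uv: "u \<in> carrier F" "v \<in> carrier F"
  assume "adj u v"
  then obtain k where k: "k \<in> K" "u \<otimes> v = \<theta> \<oplus> k" unfolding adj_def by blast
  have "\<theta> \<oplus> k \<ominus> \<theta> = k" using k(1)[THEN K_carrier] \<theta>_closed by algebra
  then show "u \<otimes> v \<ominus> \<theta> \<in> K" using k by simp
qed

lemma \<theta>_add_ne_0: "k \<in> K \<Longrightarrow> \<theta> \<oplus> k \<noteq> \<zero>"
  using \<theta>_notin sum_zero_eq_neg[of \<theta> k] by auto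

lemma common_nbr_unique:
  assumes c: "u \<in> carrier F - {\<zero>}" "v \<in> carrier F" "w \<in> carrier F - {\<zero>}" "w' \<in> carrier F"
    and "adj u w" "adj v w" "adj u w'" "adj v w'"
  shows "u = v \<or> w = w'"
proof -
  obtain k1 k2 k3 k4 where k: "k1 \<in> K" "k2 \<in> K" "k3 \<in> K" "k4 \<in> K" and
    eq: "u \<otimes> w = \<theta> \<oplus> k1" "u \<otimes> w' = \<theta> \<oplus> k2" "v \<otimes> w = \<theta> \<oplus> k3" "v \<otimes> w' = \<theta> \<oplus> k4"
    using assms(5-8) unfolding adj_def by blast
  note kc = k[THEN K_carrier]
  \<comment> \<open>Comparing coefficients of \<open>\<theta>\<close> shows that \<open>{k1, k4}\<close> and \<open>{k2, k3}\<close> have equal sums and products.\<close>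
  have "(u \<otimes> w) \<otimes> (v \<otimes> w') = (u \<otimes> w') \<otimes> (v \<otimes> w)"
    using c by (simp add: m_ac)
  then have "(\<theta> \<oplus> k1) \<otimes> (\<theta> \<oplus> k4) = (\<theta> \<oplus> k2) \<otimes> (\<theta> \<oplus> k3)" unfolding eq .
  moreover have "(\<theta> \<oplus> a) \<otimes> (\<theta> \<oplus> b) = \<theta> \<otimes> \<theta> \<oplus> (a \<otimes> b \<oplus> (a \<oplus> b) \<otimes> \<theta>)" if "a \<in> K" "b \<in> K" for a b
    using that[THEN K_carrier] \<theta>_closed by algebra
  ultimately have "k1 \<otimes> k4 \<oplus> (k1 \<oplus> k4) \<otimes> \<theta> = k2 \<otimes> k3 \<oplus> (k2 \<oplus> k3) \<otimes> \<theta>"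
    using k kc by simp
  then have *: "k1 \<otimes> k4 = k2 \<otimes> k3 \<and> k1 \<oplus> k4 = k2 \<oplus> k3"
    using k by (intro coefficients_unique[OF _ _ _ _ \<theta>_closed \<theta>_notin]) auto
  \<comment> \<open>This is the quadratic with roots \<open>k2\<close> and \<open>k3\<close>,
    evaluated at \<open>k1\<close>. By \<open>*\<close> it has the same coefficients as the one with
    roots \<open>k1\<close> and \<open>k4\<close>, so it vanishes.\<close>
  have "(k1 \<ominus> k2) \<otimes> (k1 \<ominus> k3) = k1 \<otimes> k1 \<ominus> k1 \<otimes> (k2 \<oplus> k3) \<oplus> k2 \<otimes> k3"
    using kc by algebra
  also have "\<dots> = k1 \<otimes> k1 \<ominus> k1 \<otimes> (k1 \<oplus> k4) \<oplus> k1 \<otimes> k4" using * by simp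
  also have "\<dots> = \<zero>" using kc by algebra
  finally have "k1 \<ominus> k2 = \<zero> \<or> k1 \<ominus> k3 = \<zero>" using kc by (simp add: integral_iff)
  then have "k1 = k2 \<or> k1 = k3" using kc by simp
  \<comment> \<open>Cancelling \<open>u\<close> when \<open>k1 = k2\<close> gives
    \<open>w = w'\<close>; cancelling \<open>w\<close> when \<open>k1 = k3\<close> gives
    \<open>u = v\<close>.\<close>
  then show ?thesis
    using eq c m_lcancel[of u w w'] m_rcancel[of w u v] by auto
qed

text \<open>Comparing the coefficients of \<open>\<theta>\<close> in \<open>v w = c (u w)\<close>
  forces the factor \<open>c\<close> to be \<open>\<one>\<close>.\<close>

lemma adj_par_imp_eq:
  assumes "u \<in> carrier F" "v \<in> carrier F" "w \<in> carrier F" "par u v" "adj u w" "adj v w"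
  shows "u = v"
proof -
  obtain c k l where c: "c \<in> K" "v = c \<otimes> u" and k: "k \<in> K" "u \<otimes> w = \<theta> \<oplus> k"
    and l: "l \<in> K" "v \<otimes> w = \<theta> \<oplus> l"
    using assms(4-6) unfolding par_def adj_def by blast
  have "l \<oplus> \<one> \<otimes> \<theta> = v \<otimes> w" using l by (simp add: a_comm)
  also have "\<dots> = c \<otimes> (u \<otimes> w)" using c assms by (simp add: m_assoc)
  also have "\<dots> = c \<otimes> k \<oplus> c \<otimes> \<theta>" using c k by (simp add: r_distr a_comm)
  finally have "\<one> = c"
    using coefficients_unique[of l \<one> "c \<otimes> k" c \<theta>] c k l \<theta>_notin by auto
  then show ?thesis using c(2) l_one[OF assms(1)] by metis
qed

text \<open>Write \<open>v = c u\<close> and try \<open>w = inv u (\<theta> + k)\<close>. Then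
  \<open>v w\<close> lies in \<open>\<theta> + K\<close> iff \<open>\<theta> - c \<theta>\<close>
  agrees with \<open>k c\<close> modulo \<open>K\<close>, so \<open>k\<close> is read off in the
  basis \<open>\<one>, c\<close>.\<close>

lemma common_nbr_exists:
  assumes u: "u \<in> carrier F - {\<zero>}" and v: "v \<in> carrier F" and "\<not> par u v"
  shows "\<exists>w\<in>carrier F - {\<zero>}. adj u w \<and> adj v w"
proof -
  have uU: "u \<in> Units F" "inv u \<in> carrier F" using u by (auto simp: field_Units)
  define c where "c = v \<otimes> inv u"
  have c: "c \<in> carrier F" "v = c \<otimes> u" unfolding c_def using u v uU by (auto simp: m_assoc)
  with \<open>\<not> par u v\<close> have "c \<notin> K" unfolding par_def by blast
  then obtain m k where mk: "m \<in> K" "k \<in> K" "\<theta> \<ominus> c \<otimes> \<theta> = m \<oplus> k \<otimes> c"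
    using coefficients_exist[of c "\<theta> \<ominus> c \<otimes> \<theta>"] c by auto
  define w where "w = inv u \<otimes> (\<theta> \<oplus> k)"
  have w: "w \<in> carrier F" "u \<otimes> w = \<theta> \<oplus> k"
    unfolding w_def using uU mk u by (auto simp flip: m_assoc)
  have "v \<otimes> w = c \<otimes> (\<theta> \<oplus> k)" using c w u by (simp add: m_assoc)
  also have "\<dots> = \<theta> \<ominus> (\<theta> \<ominus> c \<otimes> \<theta>) \<oplus> k \<otimes> c" using c \<theta>_closed mk(2)[THEN K_carrier] by algebra
  also have "\<dots> = \<theta> \<oplus> (\<ominus> m)" unfolding mk(3) using c \<theta>_closed mk(1,2)[THEN K_carrier] by algebra
  finally have "adj v w" unfolding adj_def using mk by blast
  moreover have "adj u w" unfolding adj_def using mk w by blast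
  moreover have "w \<noteq> \<zero>" using w \<theta>_add_ne_0[OF mk(2)] u by auto
  ultimately show ?thesis using w by blast
qed

lemma card_nbrs:
  assumes u: "u \<in> carrier F - {\<zero>}"
  shows "card {w \<in> carrier F - {\<zero>}. adj u w} = q"
proof -
  have uU: "u \<in> Units F" "inv u \<in> carrier F" using u by (auto simp: field_Units)
  have "{w \<in> carrier F - {\<zero>}. adj u w} = (\<lambda>k. inv u \<otimes> (\<theta> \<oplus> k)) ` K" (is "?N = ?f ` K")
  proof (intro equalityI subsetI)
    fix w assume "w \<in> ?N"
    then obtain k where k: "w \<in> carrier F" "k \<in> K" "u \<otimes> w = \<theta> \<oplus> k" unfolding adj_def by auto
    have "w = inv u \<otimes> (u \<otimes> w)" using uU u k(1) by (simp flip: m_assoc)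
    then show "w \<in> ?f ` K" unfolding k(3) using k(2) by blast
  next
    fix w assume "w \<in> ?f ` K"
    then obtain k where k: "k \<in> K" "w = inv u \<otimes> (\<theta> \<oplus> k)" by blast
    then have *: "w \<in> carrier F" "u \<otimes> w = \<theta> \<oplus> k"
      using uU u by (auto simp flip: m_assoc)
    moreover have "w \<noteq> \<zero>" using * \<theta>_add_ne_0[OF k(1)] u by auto
    ultimately show "w \<in> ?N" unfolding adj_def using k by auto
  qed
  moreover have "inj_on ?f K"
  proof (rule inj_onI)
    fix k l assume kl: "k \<in> K" "l \<in> K" "?f k = ?f l"
    then have "u \<otimes> ?f k = u \<otimes> ?f l" by simp
    then show "k = l" using kl uU u by (simp flip: m_assoc)
  qed
  ultimately show ?thesis using card_K by (simp add: card_image)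
qed

lemma par_sym:
  assumes "u \<in> carrier F - {\<zero>}" "v \<in> carrier F - {\<zero>}" "par u v"
  shows "par v u"
proof -
  obtain c where c: "c \<in> K" "v = c \<otimes> u" using assms unfolding par_def by blast
  then have "c \<noteq> \<zero>" using assms by auto
  with c have i: "inv c \<in> K" "inv c \<otimes> c = \<one>" using subfield_m_inv[OF K, of c] by auto
  then have "inv c \<otimes> v = u" using c assms by (simp flip: m_assoc)
  then show ?thesis unfolding par_def using i by blast
qed

lemma par_trans:
  assumes "u \<in> carrier F" "par u v" "par v w"
  shows "par u w"
proof -
  obtain c d where "c \<in> K" "v = c \<otimes> u" "d \<in> K" "w = d \<otimes> v" using assms unfolding par_def by blast
  then have "d \<otimes> c \<in> K" "w = (d \<otimes> c) \<otimes> u" using assms by (auto simp: m_assoc)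
  then show ?thesis unfolding par_def by blast
qed

lemma polarity_plane: "polarity_plane (carrier F - {\<zero>}) adj par q"
proof (rule polarity_plane.intro, goal_cases)
  case (2 u v)
  then show ?case by (auto simp: adj_def m_comm)
next
  case (3 u)
  then show ?case by (rule card_nbrs)
next
  case (4 u v)
  then show ?case by (rule par_sym)
next
  case (5 u v w)
  then show ?case using par_trans by blast
next
  case (6 u v w w')
  then show ?case by (intro common_nbr_unique[of u v w w']) auto
next
  case (7 u v w)
  then show ?case by (intro adj_par_imp_eq[of u v w]) auto
next
  case (8 u v)
  then show ?case by (intro common_nbr_exists) auto
qed (simp add: finite_F)

lemma K3_square:
  assumes "q = 3" "c \<in> K" "c \<noteq> \<zero>"
  shows "c \<otimes> c = \<one>"
proof (cases "c = \<one>")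
  case False
  have "{\<zero>, \<one>, c} = K"
    using assms False finite_K card_K by (intro card_subset_eq) auto
  moreover have "c \<otimes> c \<in> K" "c \<otimes> c \<noteq> \<zero>" "c \<otimes> c \<noteq> c"
    using assms False m_lcancel[of c c \<one>] by (auto simp: integral_iff)
  ultimately show ?thesis by auto
qed simp

text \<open>For \<open>q = 3\<close> the nonzero factors from \<open>K\<close> square to
  \<open>\<one>\<close>, so proportional elements have equal squares.\<close>

lemma absolute_par:
  assumes "q = 3" "u \<in> carrier F" "v \<in> carrier F - {\<zero>}" "par u v" "adj v v"
  shows "adj u u"
proof -
  obtain c where c: "c \<in> K" "v = c \<otimes> u" using assms unfolding par_def by blast
  then have "c \<noteq> \<zero>" using assms by auto
  have "v \<otimes> v = (c \<otimes> c) \<otimes> (u \<otimes> u)" using c assms by (simp add: m_ac)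
  also have "\<dots> = u \<otimes> u" using K3_square[OF assms(1) c(1) \<open>c \<noteq> \<zero>\<close>] assms by simp
  finally show ?thesis using assms(5) by (simp add: adj_def)
qed

section \<open>Square roots and the centre for even \<open>q\<close>\<close>

lemma pow_card: "x \<in> carrier F \<Longrightarrow> x [^] (q ^ 2) = x"
proof (cases "x = \<zero>")
  case True
  have "q ^ 2 \<noteq> 0" using order_F finite_F order_gt_0_iff_finite by force
  then show ?thesis using True by (simp add: nat_pow_zero)
next
  case False
  assume x: "x \<in> carrier F"
  interpret M: group "mult_of F" by (rule field_mult_group)
  have "x [^] (q ^ 2 - 1) = \<one>"
    using M.pow_order_eq_1[of x] x False finite_F order_F
    by (simp add: order_mult_of nat_pow_mult_of)
  moreover have "q ^ 2 = Suc (q ^ 2 - 1)" using order_F finite_F order_gt_0_iff_finite by force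
  ultimately show ?thesis using x by (metis nat_pow_Suc l_one)
qed

lemma absolute_center:
  assumes "even q"
  shows "\<exists>x\<in>carrier F - {\<zero>}. \<not> adj x x \<and> (\<forall>u\<in>carrier F. adj x u \<longleftrightarrow> adj u u)"
proof -
  \<comment> \<open>With \<open>m\<close> half of \<open>q^2\<close>, the power
    \<open>x [^] m\<close> is a square root of \<open>x\<close>.\<close>
  obtain m where m: "q ^ 2 = m * 2" using assms by (metis dvd_mult2 power2_eq_square dvd_div_mult_self)
  have sqrt: "x [^] m \<otimes> x [^] m = x" if "x \<in> carrier F" for x
    using pow_card[OF that] that unfolding m by (simp add: nat_pow_mult mult_2_right)
  \<comment> \<open>The root map is multiplicative, so \<open>-1\<close> is the root of
    \<open>(-1)(-1)\<close>, which is \<open>1\<close>: the characteristic is 2.\<close>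
  have "\<ominus> \<one> = (\<ominus> \<one>) [^] m \<otimes> (\<ominus> \<one>) [^] m" by (simp add: sqrt)
  also have "\<dots> = (\<ominus> \<one> \<otimes> \<ominus> \<one>) [^] m" by (simp add: nat_pow_distrib)
  also have "\<dots> = \<one>" by (simp add: l_minus)
  finally have "\<one> \<oplus> \<one> = \<zero>" by (metis one_closed r_neg)
  then have double: "a \<oplus> a = \<zero>" if "a \<in> carrier F" for a
    using that by (metis l_distr l_null l_one one_closed)
  then have cancel: "a = b" if "a \<oplus> b = \<zero>" "a \<in> carrier F" "b \<in> carrier F" for a b
    using that by (metis minus_equality minus_minus)
  have square: "(a \<oplus> b) \<otimes> (a \<oplus> b) = a \<otimes> a \<oplus> b \<otimes> b" if "a \<in> carrier F" "b \<in> carrier F" for a b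
  proof -
    have "(a \<oplus> b) \<otimes> (a \<oplus> b) = (a \<otimes> a \<oplus> b \<otimes> b) \<oplus> (a \<otimes> b \<oplus> a \<otimes> b)" using that by algebra
    then show ?thesis using that double by simp
  qed
  define \<eta> where "\<eta> = \<theta> [^] m"
  have \<eta>: "\<eta> \<in> carrier F" "\<eta> \<otimes> \<eta> = \<theta>" unfolding \<eta>_def using sqrt by auto
  with \<theta>_notin have "\<eta> \<notin> K" by auto
  then obtain k x where kx: "k \<in> K" "x \<in> K" "\<theta> = k \<oplus> x \<otimes> \<eta>"
    using coefficients_exist[of \<eta> \<theta>] \<eta> by auto
  have "x \<noteq> \<zero>" using kx \<eta> \<theta>_notin by auto
  note kxc = kx(1,2)[THEN K_carrier]
  have adj_self: "adj u u \<longleftrightarrow> (\<exists>d\<in>K. u = \<eta> \<oplus> d)" if u: "u \<in> carrier F" for u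
  proof
    assume "adj u u"
    then obtain l where l: "l \<in> K" "u \<otimes> u = \<theta> \<oplus> l" unfolding adj_def by blast
    \<comment> \<open>The root of \<open>l\<close> is a power of \<open>l\<close> and therefore
      stays in \<open>K\<close>.\<close>
    define d where "d = l [^] m"
    have d: "d \<in> K" "d \<otimes> d = l" unfolding d_def using l sqrt by auto
    have "(u \<oplus> (\<eta> \<oplus> d)) \<otimes> (u \<oplus> (\<eta> \<oplus> d)) = u \<otimes> u \<oplus> (\<eta> \<otimes> \<eta> \<oplus> d \<otimes> d)"
      using u \<eta> d by (simp add: square)
    also have "\<dots> = \<zero>" using l d \<eta> by (simp add: double)
    finally have "u \<oplus> (\<eta> \<oplus> d) = \<zero>" using u \<eta> d by (simp add: integral_iff)
    then show "\<exists>d\<in>K. u = \<eta> \<oplus> d" using cancel u \<eta> d by blast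
  next
    assume "\<exists>d\<in>K. u = \<eta> \<oplus> d"
    then show "adj u u" unfolding adj_def using \<eta> square by auto
  qed
  have "adj x u \<longleftrightarrow> adj u u" if u: "u \<in> carrier F" for u
    unfolding adj_self[OF u]
  proof
    assume "adj x u"
    then obtain l where l: "l \<in> K" "x \<otimes> u = \<theta> \<oplus> l" unfolding adj_def by blast
    \<comment> \<open>Inserting the expansion of \<open>\<theta>\<close> leaves an element of
      \<open>K\<close>, from which the nonzero factor \<open>x\<close> can be cancelled.\<close>
    have "x \<otimes> (u \<ominus> \<eta>) = x \<otimes> u \<ominus> x \<otimes> \<eta>" using u \<eta>(1) kxc by algebra
    also have "\<dots> = (k \<oplus> x \<otimes> \<eta>) \<oplus> l \<ominus> x \<otimes> \<eta>" using l kx(3) by simp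
    also have "\<dots> = k \<oplus> l" using \<eta>(1) kxc l(1)[THEN K_carrier] by algebra
    finally have "u \<ominus> \<eta> \<in> K" using K_cancel[OF kx(2) \<open>x \<noteq> \<zero>\<close>, of "u \<ominus> \<eta>"] u \<eta> kx l by auto
    moreover have "u = \<eta> \<oplus> (u \<ominus> \<eta>)" using u \<eta>(1) by algebra
    ultimately show "\<exists>d\<in>K. u = \<eta> \<oplus> d" by blast
  next
    assume "\<exists>d\<in>K. u = \<eta> \<oplus> d"
    then obtain d where d: "d \<in> K" "u = \<eta> \<oplus> d" by blast
    have "x \<otimes> u = (k \<oplus> x \<otimes> \<eta>) \<oplus> (x \<otimes> d \<ominus> k)"
      unfolding d(2) using \<eta>(1) kxc d(1)[THEN K_carrier] by algebra
    then show "adj x u" unfolding adj_def kx(3)[symmetric] using kx d by blast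
  qed
  \<comment> \<open>Absolute points have the form \<open>\<eta> + d\<close> and lie outside
    \<open>K\<close>, whereas \<open>x\<close> lies in \<open>K\<close>.\<close>
  moreover have "\<not> adj x x"
  proof
    assume "adj x x"
    then obtain d where "d \<in> K" "x = \<eta> \<oplus> d" using adj_self kx by blast
    moreover have "\<eta> = \<eta> \<oplus> d \<ominus> d" if "d \<in> K" for d using \<eta>(1) that[THEN K_carrier] by algebra
    ultimately show False using kx(2) \<open>\<eta> \<notin> K\<close> K_minus by metis
  qed
  ultimately have "\<not> adj x x \<and> (\<forall>u\<in>carrier F. adj x u \<longleftrightarrow> adj u u)" by blast
  then show ?thesis using kxc(2) \<open>x \<noteq> \<zero>\<close> by blast
qed

end

section \<open>Exponents of a generator\<close>

lemma (in group) int_pow_mod_order: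
  assumes "a \<in> carrier G"
  shows "a [^] (i mod int (order G)) = a [^] i"
proof -
  have "a [^] (int (order G) * (i div int (order G))) = \<one>"
    using assms by (simp flip: int_pow_pow add: int_pow_int pow_order_eq_1)
  then have "a [^] (i mod int (order G)) = a [^] (int (order G) * (i div int (order G))) \<otimes> a [^] (i mod int (order G))"
    using assms by simp
  also have "\<dots> = a [^] i"
    using int_pow_mult[OF assms, of "int (order G) * (i div int (order G))" "i mod int (order G)"] by simp
  finally show ?thesis .
qed

text \<open>Reducing exponents modulo the order gives surjectivity; injectivity follows because both
  sides have the same finite size.\<close>

lemma (in group) bij_betw_int_pow_generator:
  assumes fin: "finite (carrier G)" and a: "a \<in> carrier G" and gen: "generate G {a} = carrier G"
  shows "bij_betw (\<lambda>i::int. a [^] i) {0..<int (order G)} (carrier G)"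
proof -
  have pos: "int (order G) > 0" using fin order_gt_0_iff_finite by simp
  have "(\<lambda>i::int. a [^] i) ` {0..<int (order G)} = carrier G"
  proof (intro equalityI subsetI)
    fix x assume "x \<in> carrier G"
    then obtain k :: int where "x = a [^] k" using gen generate_pow[OF a] by auto
    then have "x = a [^] (k mod int (order G))" by (simp add: int_pow_mod_order[OF a])
    then show "x \<in> (\<lambda>i::int. a [^] i) ` {0..<int (order G)}" using pos by simp
  qed (use a in auto)
  then show ?thesis
    unfolding bij_betw_def using eq_card_imp_inj_on[of "{0..<int (order G)}" "\<lambda>i::int. a [^] i"]
    by (simp add: order_def)
qed

text \<open>The powers of an element of \<open>K\<close> stay in \<open>K\<close>, which is too
  small to contain all of \<open>F\<close>.\<close>

lemma (in field) generator_notin_subfield: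
  assumes "finite (carrier R)" "subfield K R" "card K < order R"
    and "generate (mult_of R) {\<theta>} = carrier (mult_of R)"
  shows "\<theta> \<notin> K"
proof
  assume "\<theta> \<in> K"
  interpret M: group "mult_of R" by (rule field_mult_group)
  have "\<theta> \<in> generate (mult_of R) {\<theta>}" by (rule generate.incl) simp
  with assms(4) \<open>\<theta> \<in> K\<close> have "{\<theta>} \<subseteq> K - {\<zero>}" by simp
  then have "carrier (mult_of R) \<subseteq> K - {\<zero>}"
    using M.generate_subgroup_incl[OF _ subgroup_mult_of[OF assms(2)]] assms(4) by metis
  then have "carrier R \<subseteq> K" using subringE(2)[OF subfieldE(1)[OF assms(2)]] by auto
  then have "order R \<le> card K"
    unfolding order_def using assms(1) subfieldE(3)[OF assms(2)] by (intro card_mono finite_subset[of K]) auto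
  with assms(3) show False by simp
qed

theorem theorem1p7:
  fixes F :: "('a, 'b) ring_scheme" and K :: "'a set" and \<theta> :: 'a and q :: nat
  assumes "primepow q" and "q \<noteq> 2"
    and "field F" and "finite (carrier F)" and "order F = q ^ 2"
    and "subfield K F" and "card K = q"
    and "\<theta> \<in> carrier (mult_of F)" and "generate (mult_of F) {\<theta>} = carrier (mult_of F)"
  shows "C4_saturated (G_graph q F K \<theta>) \<and>
         ((\<exists>k::nat. q = 2 ^ k) \<and> q > 4 \<longrightarrow> C4_saturated (H_graph q F K \<theta>))"
proof -
  interpret field F by fact
  \<comment> \<open>For \<open>q = 2\<close> the graph is a path on three vertices, and its missing
    edge closes only a triangle.\<close>
  have "q \<ge> 3" using primepow_gt_Suc_0[OF assms(1)] assms(2) by simp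
  then have "q < q ^ 2" by (simp add: power2_eq_square)
  then have "\<theta> \<notin> K"
    using assms(4-7,9) by (intro generator_notin_subfield) simp_all
  have "\<theta> \<in> carrier F" using assms(8) by simp
  interpret quadratic_extension F K \<theta> q
    by (intro quadratic_extension.intro quadratic_extension_axioms.intro) fact+
  interpret M: group "mult_of F" by (rule field_mult_group)
  define V where "V = carrier (Zmod q)"
  define f where "f i = \<theta> [^]\<^bsub>mult_of F\<^esub> i" for i :: int
  define E where "E i j = adj (f i) (f j)" for i j
  have order: "int (order (mult_of F)) = int q ^ 2 - 1"
    using assms(4,5) \<open>q < q ^ 2\<close> by (simp add: order_mult_of of_nat_diff)
  have V: "V = {0..<int (order (mult_of F))}"
    unfolding V_def order by (auto simp: residue_ring_def)
  have bij: "bij_betw f V (carrier F - {\<zero>\<^bsub>F\<^esub>})"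
    using M.bij_betw_int_pow_generator[OF _ assms(8,9)] assms(4) unfolding V f_def by simp
  then have f: "f i \<in> carrier F - {\<zero>\<^bsub>F\<^esub>}" if "i \<in> V" for i
    using that by (auto dest: bij_betwE)
  interpret polarity_plane V E "\<lambda>i j. par (f i) (f j)" q
    unfolding E_def by (rule polarity_plane.polarity_plane_pullback[OF polarity_plane bij])
  \<comment> \<open>Adding exponents modulo \<open>q^2 - 1\<close> multiplies the corresponding
    field elements.\<close>
  have sum_in_A: "i \<oplus>\<^bsub>Zmod q\<^esub> j \<in> A_set q F K \<theta> \<longleftrightarrow> E i j" if "i \<in> V" "j \<in> V" for i j
  proof -
    have sum: "i \<oplus>\<^bsub>Zmod q\<^esub> j = (i + j) mod int (order (mult_of F))"
      unfolding order by (simp add: residue_ring_def)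
    then have "i \<oplus>\<^bsub>Zmod q\<^esub> j \<in> V"
      unfolding V using \<open>i \<in> V\<close> by (auto simp: V)
    moreover have "\<theta> [^]\<^bsub>mult_of F\<^esub> (i \<oplus>\<^bsub>Zmod q\<^esub> j) = f i \<otimes>\<^bsub>F\<^esub> f j"
      unfolding sum M.int_pow_mod_order[OF assms(8)] f_def using M.int_pow_mult[OF assms(8)] by simp
    ultimately show ?thesis
      using f[OF that(1)] f[OF that(2)] unfolding A_set_def E_def by (simp add: V_def adj_iff)
  qed
  have G: "G_graph q F K \<theta> = relation_graph V E"
    unfolding G_graph_def relation_graph_def V_def[symmetric] using sum_in_A by auto
  have "C4_saturated (G_graph q F K \<theta>)"
    unfolding G
  proof (rule C4_saturated_polarity_graph[OF \<open>q \<ge> 3\<close>])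
    show "E u u" if "q = 3" "u \<in> V" "v \<in> V" "par (f u) (f v)" "E v v" for u v
      using absolute_par[OF that(1) _ _ that(4)] f that unfolding E_def by blast
  qed
  moreover have "C4_saturated (H_graph q F K \<theta>)" if q: "\<exists>k::nat. q = 2 ^ k" "q > 4"
  proof -
    obtain k :: nat where k: "q = 2 ^ k" using q by blast
    with q(2) have "even q" by (cases k) auto
    then obtain c where c: "c \<in> carrier F - {\<zero>\<^bsub>F\<^esub>}" "\<not> adj c c" "\<And>u. u \<in> carrier F \<Longrightarrow> adj c u \<longleftrightarrow> adj u u"
      using absolute_center by blast
    \<comment> \<open>The vertex \<open>x\<close> is the discrete logarithm of the central field
      element \<open>c\<close>.\<close>
    then obtain x where x: "x \<in> V" "f x = c"
      using bij by (metis bij_betw_imp_surj_on imageE)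
    have x_adj: "E x u \<longleftrightarrow> E u u" if "u \<in> V" for u
      unfolding E_def x(2) using c(3) f[OF that] by blast
    have nbhd: "neighborhood (relation_graph V E) y = {z \<in> V. y \<noteq> z \<and> E y z}" if "y \<in> V" for y
      using that by (auto simp: neighborhood_def relation_graph_def)
    have abs: "absolute_points q F K \<theta> = {z \<in> V. E z z}"
      unfolding absolute_points_def V_def[symmetric] using sum_in_A by auto
    \<comment> \<open>As \<open>c\<close> is not absolute, excluding \<open>z = x\<close> removes
      nothing.\<close>
    have nbhd_x: "{z \<in> V. x \<noteq> z \<and> E x z} = {z \<in> V. E z z}"
      using x_adj c(2) x unfolding E_def by blast
    have "center q F K \<theta> = x"
      unfolding center_def G abs
    proof (rule the_equality)
      show "x \<in> pverts (relation_graph V E) \<and> neighborhood (relation_graph V E) x = {z \<in> V. E z z}"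
        using x nbhd nbhd_x by (simp add: relation_graph_def)
    next
      fix y assume y: "y \<in> pverts (relation_graph V E) \<and> neighborhood (relation_graph V E) y = {z \<in> V. E z z}"
      then have "y \<in> V" by (simp add: relation_graph_def)
      with y nbhd show "y = x"
        using \<open>q \<ge> 3\<close> by (intro center_unique[OF _ x(1) x_adj]) auto
    qed
    moreover have "V - ({x} \<union> neighborhood (relation_graph V E) x) = V - ({x} \<union> {z \<in> V. E x z})"
      using nbhd[OF x(1)] by auto
    ultimately have "H_graph q F K \<theta> = relation_graph (V - ({x} \<union> {z \<in> V. E x z})) E"
      unfolding H_graph_def G Let_def by (auto simp: relation_graph_def induced_on_def)
    then show ?thesis
      using C4_saturated_delete_center[OF _ x(1) x_adj] q(2) by simp
  qed
  ultimately show ?thesis by blast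
qed

end
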